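(* Let $n \geq 1$ and let $\lambda \in \mathbb{T}$. Then every point derivation at $\varphi_{\lambda}: \mathcal{T}^{+}(\mathcal{C}_n) \rightarrow M_n$ is inner at $\varphi_\lambda$.
   Context: $\mathbb{T}$ is the unit circle. $A(\mathbb{D})$ is the disk algebra: functions holomorphic on the open unit disk $\mathbb{D}$ and continuous on $\overline{\mathbb{D}}$, with the supremum norm. For $1 \leq i,j \leq n$ let $\ell(i,j) \in \{0,1,\dots,n-1\}$ be the residue of $j-i$ modulo $n$. The algebra $\mathcal{T}^{+}(\mathcal{C}_n)$ is the subalgebra of $M_n \otimes A(\mathbb{D}) = M_n(A(\mathbb{D}))$ consisting of all matrices $[z^{\ell(i,j)} f_{i,j}(z^n)]_{i,j=1}^n$ with $f_{i,j} \in A(\mathbb{D})$ for all $i,j$, with the norm inherited from $M_n \otimes A(\mathbb{D})$ (the supremum over $z \in \overline{\mathbb{D}}$ of the operator norm of the matrix at $z$). For $\lambda \in \overline{\mathbb{D}}$, the representation $\varphi_{\lambda}: \mathcal{T}^{+}(\mathcal{C}_n) \to M_n$ is defined by $\varphi_{\lambda}([z^{\ell(i,j)} f_{i,j}(z^n)]) = [\lambda^{\ell(i,j)} f_{i,j}(\lambda^n)]$ (with $0^0=1$). For a representation $\pi: A \to B(\mathcal{H})$ of an operator algebra $A$ (a continuous representation by operators on a Hilbert space $\mathcal{H}$), a point derivation at $\pi$ (or derivation at $\pi$) is a continuous linear map $D: A \to B(\mathcal{H})$ with $D(ab) = D(a)\pi(b) + \pi(a)D(b)$ for all $a,b \in A$.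 It is inner at $\pi$ if there is $X \in B(\mathcal{H})$ such that $D(a) = \pi(a)X - X\pi(a)$ for all $a \in A$. Here $\mathcal{H} = \mathbb{C}^n$ and $B(\mathcal{H}) = M_n$. *)

theory Defs
  imports "HOL-Complex_Analysis.Complex_Analysis"
begin

text \<open>
  The index set of the matrices is a finite type \<open>'n\<close>, so \<open>n = CARD('n) \<ge> 1\<close>, labelled by
  \<open>1, \<dots>, n\<close> through a bijection \<open>e\<close>. The space \<open>complex ^ 'n\<close> carries the Euclidean norm, so that
  \<open>complex ^ 'n ^ 'n\<close> with \<open>**\<close> and the norm below is the operator algebra \<open>B(\<complex>\<^sup>n)\<close>.
  The library's own norm on \<open>complex ^ 'n ^ 'n\<close> is the Frobenius norm, and its \<open>*\<close> is entrywise.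
\<close>

definition op_norm :: "complex ^ 'n ^ 'n \<Rightarrow> real" where
  "op_norm M = onorm (\<lambda>v. M *v v)"

definition scale_mat :: "complex \<Rightarrow> complex ^ 'n ^ 'n \<Rightarrow> complex ^ 'n ^ 'n" where
  "scale_mat c M = (\<chi> i j. c * M $ i $ j)"

text \<open>
  Functions on the closed disk are represented by total functions that vanish outside it, so that
  equality on the closed disk is equality of functions.
\<close>

definition disk_algebra :: "(complex \<Rightarrow> complex) set" where
  "disk_algebra = {f. continuous_on (cball 0 1) f \<and> f holomorphic_on ball 0 1 \<and>
     (\<forall>z. z \<notin> cball 0 1 \<longrightarrow> f z = 0)}"

definition cyc_len :: "('n::finite \<Rightarrow> nat) \<Rightarrow> 'n \<Rightarrow> 'n \<Rightarrow> nat" where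
  "cyc_len e i j = nat ((int (e j) - int (e i)) mod int CARD('n))"

text \<open>For \<open>\<bar>z\<bar> > 1\<close> also \<open>\<bar>z ^ n\<bar> > 1\<close>, so these functions again vanish outside the closed disk.\<close>

definition cycle_fun ::
  "('n::finite \<Rightarrow> nat) \<Rightarrow> ('n \<Rightarrow> 'n \<Rightarrow> complex \<Rightarrow> complex) \<Rightarrow> complex \<Rightarrow> complex ^ 'n ^ 'n" where
  "cycle_fun e f = (\<lambda>z. \<chi> i j. z ^ cyc_len e i j * f i j (z ^ CARD('n)))"

definition cycle_algebra :: "('n::finite \<Rightarrow> nat) \<Rightarrow> (complex \<Rightarrow> complex ^ 'n ^ 'n) set" where
  "cycle_algebra e = {cycle_fun e f | f. \<forall>i j. f i j \<in> disk_algebra}"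

definition disk_norm :: "(complex \<Rightarrow> complex ^ 'n ^ 'n) \<Rightarrow> real" where
  "disk_norm F = (SUP z\<in>cball 0 1. op_norm (F z))"

definition phi :: "complex \<Rightarrow> (complex \<Rightarrow> complex ^ 'n ^ 'n) \<Rightarrow> complex ^ 'n ^ 'n" where
  "phi lam F = F lam"

lemma phi_cycle_fun:
  "phi lam (cycle_fun e f) =
     (\<chi> i j. lam ^ cyc_len e i j * f i j (lam ^ CARD('n)))" for e :: "'n::finite \<Rightarrow> nat"
  by (simp add: phi_def cycle_fun_def)

text \<open>
  Here \<open>A\<close> is an algebra of matrix functions on the closed disk, normed by \<^const>\<open>disk_norm\<close>.
  The values of \<open>D\<close> outside \<open>A\<close> are irrelevant.
\<close>

definition linear_on_algebra ::
  "(complex \<Rightarrow> complex ^ 'n ^ 'n) set \<Rightarrow> ((complex \<Rightarrow> complex ^ 'n ^ 'n) \<Rightarrow> complex ^ 'n ^ 'n) \<Rightarrow> bool"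
where
  "linear_on_algebra A D \<longleftrightarrow>
     (\<forall>F\<in>A. \<forall>G\<in>A. D (\<lambda>z. F z + G z) = D F + D G) \<and>
     (\<forall>c. \<forall>F\<in>A. D (\<lambda>z. scale_mat c (F z)) = scale_mat c (D F))"

definition continuous_on_algebra ::
  "(complex \<Rightarrow> complex ^ 'n ^ 'n) set \<Rightarrow> ((complex \<Rightarrow> complex ^ 'n ^ 'n) \<Rightarrow> complex ^ 'n ^ 'n) \<Rightarrow> bool"
where
  "continuous_on_algebra A D \<longleftrightarrow>
     (\<forall>F\<in>A. \<forall>\<epsilon>>0. \<exists>\<delta>>0. \<forall>G\<in>A.
        disk_norm (\<lambda>z. G z - F z) < \<delta> \<longrightarrow> op_norm (D G - D F) < \<epsilon>)"

definition point_derivation ::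
  "(complex \<Rightarrow> complex ^ 'n ^ 'n) set \<Rightarrow> ((complex \<Rightarrow> complex ^ 'n ^ 'n) \<Rightarrow> complex ^ 'n ^ 'n) \<Rightarrow>
    ((complex \<Rightarrow> complex ^ 'n ^ 'n) \<Rightarrow> complex ^ 'n ^ 'n) \<Rightarrow> bool"
where
  "point_derivation A \<pi> D \<longleftrightarrow>
     linear_on_algebra A D \<and> continuous_on_algebra A D \<and>
     (\<forall>F\<in>A. \<forall>G\<in>A. D (\<lambda>z. F z ** G z) = D F ** \<pi> G + \<pi> F ** D G)"

definition inner_at ::
  "(complex \<Rightarrow> complex ^ 'n ^ 'n) set \<Rightarrow> ((complex \<Rightarrow> complex ^ 'n ^ 'n) \<Rightarrow> complex ^ 'n ^ 'n) \<Rightarrow>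
    ((complex \<Rightarrow> complex ^ 'n ^ 'n) \<Rightarrow> complex ^ 'n ^ 'n) \<Rightarrow> bool"
where
  "inner_at A \<pi> D \<longleftrightarrow> (\<exists>X. \<forall>F\<in>A. D F = \<pi> F ** X - X ** \<pi> F)"

end

theory Submission imports Defs begin

text \<open>
  The scalar functions \<open>1 - t\<mu> / ((1 + t)\<mu> - w)\<close> with \<open>\<mu> = \<lambda>\<^sup>n\<close> and \<open>t \<rightarrow> 0\<^sup>+\<close> vanish at
  \<open>w = \<mu>\<close> and, after the substitution \<open>w = z\<^sup>n\<close>, form an approximate unit for the kernel of \<open>\<phi>\<^sub>\<lambda>\<close>;
  this is where \<open>\<bar>\<lambda>\<bar> = 1\<close> enters. A point derivation kills products of two elements of the kernel,
  hence by continuity the whole kernel. Since \<open>\<phi>\<^sub>\<lambda>\<close> maps onto \<open>M\<^sub>n\<close>, the derivation descends to a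
  derivation of \<open>M\<^sub>n\<close>, and these are inner.
\<close>

section \<open>Derivations of the full matrix algebra\<close>

lemma matrix_add_rdistrib: "(A + B) ** C = A ** C + B ** C"
  by (simp add: vec_eq_iff matrix_matrix_mult_def distrib_right sum.distrib)

lemma matrix_mult_sum_left: "sum f A ** M = (\<Sum>x\<in>A. f x ** (M :: complex ^ 'n ^ 'n))"
  for f :: "'b \<Rightarrow> complex ^ 'n ^ 'n"
  by (induction A rule: infinite_finite_induct) (auto simp: matrix_add_rdistrib)

lemma matrix_mult_sum_right: "M ** sum f A = (\<Sum>x\<in>A. M ** (f x :: complex ^ 'n ^ 'n))"
  for M :: "complex ^ 'n ^ 'n"
  by (induction A rule: infinite_finite_induct) (auto simp: matrix_add_ldistrib)

lemma scale_mat_matrix_mult_left: "scale_mat c M ** N = scale_mat c (M ** N)"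
  by (simp add: vec_eq_iff scale_mat_def matrix_matrix_mult_def sum_distrib_left mult_ac)

lemma scale_mat_matrix_mult_right: "M ** scale_mat c N = scale_mat c (M ** N)"
  by (simp add: vec_eq_iff scale_mat_def matrix_matrix_mult_def sum_distrib_left mult_ac)

text \<open>With matrix units \<open>E i j\<close>, the tensor formed by summing
  \<open>E i k\<close> \<otimes> \<open>E k i\<close> over \<open>i\<close> multiplies out to the
  identity, and multiplying it by \<open>M\<close> on the far left or on the far right gives the
  same result. Applying \<open>d\<close> to the left factors and multiplying yields
  \<open>Y\<close>, and these two properties turn the Leibniz rule into
  \<open>d M + M ** Y = Y ** M\<close>.\<close>

lemma matrix_derivation_inner:
  fixes d :: "complex ^ 'n ^ 'n \<Rightarrow> complex ^ 'n ^ 'n"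
  assumes add: "\<And>M N. d (M + N) = d M + d N"
    and scale: "\<And>c M. d (scale_mat c M) = scale_mat c (d M)"
    and mult: "\<And>M N. d (M ** N) = d M ** N + M ** d N"
  shows "\<exists>X. \<forall>M. d M = M ** X - X ** M"
proof -
  \<comment> \<open>Any index serves: types are inhabited and the conclusion does not mention
    \<open>k\<close>.\<close>
  fix k :: 'n
  define E :: "'n \<Rightarrow> 'n \<Rightarrow> complex ^ 'n ^ 'n" where
    "E = (\<lambda>i j. \<chi> a b. of_bool (a = i) * of_bool (b = j))"
  define Y where "Y = (\<Sum>i\<in>UNIV. d (E i k) ** E k i)"
  have d0: "d 0 = 0" using add[of 0 0] by simp
  have d_sum: "d (sum f A) = (\<Sum>x\<in>A. d (f x))" for f :: "'n \<Rightarrow> _" and A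
    by (induction A rule: infinite_finite_induct) (auto simp: add d0)
  \<comment> \<open>\<open>M_E\<close> and \<open>E_M\<close> have the same coefficients
    \<open>M $ p $ i\<close>. This is what lets \<open>M\<close> pass from the left factor to the
    right one once the two sums are exchanged.\<close>
  have M_E: "M ** E i k = (\<Sum>p\<in>UNIV. scale_mat (M $ p $ i) (E p k))" for M i
    by (simp add: vec_eq_iff E_def scale_mat_def matrix_matrix_mult_def
        flip: mult.assoc sum_distrib_right)
  have E_M: "E k p ** M = (\<Sum>i\<in>UNIV. scale_mat (M $ p $ i) (E k i))" for M p
    by (simp add: vec_eq_iff E_def scale_mat_def matrix_matrix_mult_def mult_ac
        flip: sum_distrib_left)
  have E_one: "(\<Sum>i\<in>UNIV. E i k ** E k i) = mat 1"
    by (simp add: vec_eq_iff E_def mat_def matrix_matrix_mult_def mult_ac flip: sum_distrib_left)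
  have "d M + M ** Y = Y ** M" for M
  proof -
    \<comment> \<open>The identity is inserted in the form \<open>E_one\<close>, so that each
      summand completes the Leibniz rule for \<open>M ** E i k\<close>.\<close>
    have "d M = (\<Sum>i\<in>UNIV. d M ** E i k ** E k i)"
      by (simp only: matrix_mul_assoc[symmetric] matrix_mult_sum_right[symmetric] E_one
          matrix_mul_rid)
    moreover have "M ** Y = (\<Sum>i\<in>UNIV. M ** d (E i k) ** E k i)"
      by (simp only: Y_def matrix_mult_sum_right matrix_mul_assoc)
    ultimately have "d M + M ** Y = (\<Sum>i\<in>UNIV. (d M ** E i k + M ** d (E i k)) ** E k i)"
      by (simp only: matrix_add_rdistrib sum.distrib)
    also have "\<dots> = (\<Sum>i\<in>UNIV. d (M ** E i k) ** E k i)"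
      by (simp add: mult)
    also have "\<dots> = (\<Sum>i\<in>UNIV. \<Sum>p\<in>UNIV. d (E p k) ** scale_mat (M $ p $ i) (E k i))"
      by (simp add: M_E d_sum scale matrix_mult_sum_left scale_mat_matrix_mult_left
          scale_mat_matrix_mult_right)
    also have "\<dots> = (\<Sum>p\<in>UNIV. d (E p k) ** (E k p ** M))"
      by (subst sum.swap) (simp add: E_M matrix_mult_sum_right)
    also have "\<dots> = Y ** M"
      by (simp add: Y_def matrix_mult_sum_left matrix_mul_assoc)
    finally show ?thesis .
  qed
  moreover have "M ** (- Y) = - (M ** Y)" "(- Y) ** M = - (Y ** M)" for M
    by (simp_all add: vec_eq_iff matrix_matrix_mult_def sum_negf)
  ultimately have "d M = M ** (- Y) - (- Y) ** M" for M
    by (simp add: eq_diff_eq)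
  thus ?thesis by blast
qed

section \<open>Closure properties of the disk algebra\<close>

lemma disk_algebra_restrict:
  assumes "continuous_on (cball 0 1) g" "g holomorphic_on ball 0 1"
  shows "(\<lambda>z. if z \<in> cball 0 1 then g z else 0) \<in> disk_algebra"
proof -
  \<comment> \<open>The cut-off changes nothing on the closed disk; it supplies the value 0 outside,
    by which even constants must be truncated to represent elements of
    \<open>disk_algebra\<close>.\<close>
  have "continuous_on (cball 0 1) (\<lambda>z. if z \<in> cball 0 1 then g z else 0)"
    using assms(1) by (rule continuous_on_eq) auto
  moreover have "(\<lambda>z. if z \<in> cball 0 1 then g z else 0) holomorphic_on ball 0 1"
    using assms(2) by (rule holomorphic_transform) auto
  ultimately show ?thesis by (auto simp: disk_algebra_def)
qed

lemma disk_algebra_zero: "(\<lambda>z. 0) \<in> disk_algebra"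
  by (simp add: disk_algebra_def)

lemma disk_algebra_add:
  "f \<in> disk_algebra \<Longrightarrow> g \<in> disk_algebra \<Longrightarrow> (\<lambda>z. f z + g z) \<in> disk_algebra"
  by (auto simp: disk_algebra_def intro!: continuous_intros holomorphic_intros)

lemma disk_algebra_mult:
  "f \<in> disk_algebra \<Longrightarrow> g \<in> disk_algebra \<Longrightarrow> (\<lambda>z. f z * g z) \<in> disk_algebra"
  by (auto simp: disk_algebra_def intro!: continuous_intros holomorphic_intros)

lemma disk_algebra_cmult: "f \<in> disk_algebra \<Longrightarrow> (\<lambda>z. c * f z) \<in> disk_algebra"
  by (auto simp: disk_algebra_def intro!: continuous_intros holomorphic_intros)

lemma disk_algebra_power_mult: "f \<in> disk_algebra \<Longrightarrow> (\<lambda>z. z ^ m * f z) \<in> disk_algebra"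
  by (auto simp: disk_algebra_def intro!: continuous_intros holomorphic_intros)

lemma disk_algebra_sum:
  "(\<And>x. x \<in> A \<Longrightarrow> f x \<in> disk_algebra) \<Longrightarrow> (\<lambda>z. \<Sum>x\<in>A. f x z) \<in> disk_algebra"
  by (induction A rule: infinite_finite_induct) (auto intro: disk_algebra_add disk_algebra_zero)

section \<open>Exponent arithmetic and closure of the cycle algebra\<close>

lemma cyc_len_self: "cyc_len e i i = 0"
  by (simp add: cyc_len_def)

text \<open>Both path lengths from \<open>i\<close> to \<open>j\<close> are congruent modulo n to
  \<open>e j - e i\<close>, and \<open>cyc_len e i j\<close> is the reduced residue. The excess n *
  m matters in products: z^(n m) = (z^n)^m is again a function of z^n.\<close>

lemma cyc_len_triangle:
  fixes e :: "'n::finite \<Rightarrow> nat"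
  shows "\<exists>m. cyc_len e i k + cyc_len e k j = cyc_len e i j + CARD('n) * m"
proof -
  let ?n = "int CARD('n)"
  have int_len: "int (cyc_len e a b) = (int (e b) - int (e a)) mod ?n" for a b
    by (simp add: cyc_len_def)
  have "cyc_len e i j < CARD('n)"
    unfolding cyc_len_def by (simp add: nat_less_iff)
  moreover have "(int (cyc_len e i k) + int (cyc_len e k j)) mod ?n = int (cyc_len e i j)"
    unfolding int_len by (simp add: mod_simps)
  hence "(cyc_len e i k + cyc_len e k j) mod CARD('n) = cyc_len e i j"
    by (metis of_nat_add of_nat_eq_iff zmod_int)
  ultimately show ?thesis
    by (metis mod_mult_div_eq)
qed

text \<open>The functions \<open>f i j\<close> can be chosen independently of each other, so
  membership becomes a condition on single entries, which is the form used for the closure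
  properties.\<close>

lemma cycle_algebra_iff:
  fixes e :: "'n::finite \<Rightarrow> nat"
  shows "F \<in> cycle_algebra e \<longleftrightarrow>
    (\<forall>i j. \<exists>f\<in>disk_algebra. \<forall>z. F z $ i $ j = z ^ cyc_len e i j * f (z ^ CARD('n)))"
    (is "_ \<longleftrightarrow> ?R")
proof
  show "F \<in> cycle_algebra e \<Longrightarrow> ?R"
    unfolding cycle_algebra_def cycle_fun_def by fastforce
next
  assume ?R
  then obtain f where "\<And>i j. f i j \<in> disk_algebra"
    "\<And>i j z. F z $ i $ j = z ^ cyc_len e i j * f i j (z ^ CARD('n))"
    by metis
  thus "F \<in> cycle_algebra e"
    unfolding cycle_algebra_def
    by (auto intro!: exI[of _ f] simp: cycle_fun_def vec_eq_iff fun_eq_iff)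
qed

lemma cycle_algebra_add:
  assumes "F \<in> cycle_algebra e" "G \<in> cycle_algebra e"
  shows "(\<lambda>z. F z + G z) \<in> cycle_algebra e"
  unfolding cycle_algebra_iff
proof (intro allI)
  fix i j
  obtain f g where "f \<in> disk_algebra" "g \<in> disk_algebra"
    "\<And>z. F z $ i $ j = z ^ cyc_len e i j * f (z ^ CARD('a))"
    "\<And>z. G z $ i $ j = z ^ cyc_len e i j * g (z ^ CARD('a))"
    using assms unfolding cycle_algebra_iff by metis
  thus "\<exists>h\<in>disk_algebra. \<forall>z. (F z + G z) $ i $ j = z ^ cyc_len e i j * h (z ^ CARD('a))"
    by (intro bexI[of _ "\<lambda>w. f w + g w"]) (auto simp: disk_algebra_add algebra_simps)
qed

lemma cycle_algebra_scale:
  assumes "F \<in> cycle_algebra e"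
  shows "(\<lambda>z. scale_mat c (F z)) \<in> cycle_algebra e"
  unfolding cycle_algebra_iff
proof (intro allI)
  fix i j
  obtain f where "f \<in> disk_algebra" "\<And>z. F z $ i $ j = z ^ cyc_len e i j * f (z ^ CARD('a))"
    using assms unfolding cycle_algebra_iff by metis
  thus "\<exists>h\<in>disk_algebra. \<forall>z. scale_mat c (F z) $ i $ j = z ^ cyc_len e i j * h (z ^ CARD('a))"
    by (intro bexI[of _ "\<lambda>w. c * f w"]) (auto simp: disk_algebra_cmult scale_mat_def)
qed

lemma cycle_algebra_mult:
  fixes e :: "'n::finite \<Rightarrow> nat"
  assumes "F \<in> cycle_algebra e" "G \<in> cycle_algebra e"
  shows "(\<lambda>z. F z ** G z) \<in> cycle_algebra e"
  unfolding cycle_algebra_iff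
proof (intro allI)
  fix i j
  obtain f g where fg: "\<And>i j. f i j \<in> disk_algebra" "\<And>i j. g i j \<in> disk_algebra"
    "\<And>i j z. F z $ i $ j = z ^ cyc_len e i j * f i j (z ^ CARD('n))"
    "\<And>i j z. G z $ i $ j = z ^ cyc_len e i j * g i j (z ^ CARD('n))"
    using assms unfolding cycle_algebra_iff by metis
  obtain m where m: "\<And>k. cyc_len e i k + cyc_len e k j = cyc_len e i j + CARD('n) * m k"
    using cyc_len_triangle by metis
  \<comment> \<open>The factor \<open>w ^ m k\<close> absorbs the surplus exponent of the path
    through \<open>k\<close>, where \<open>w\<close> stands for z^n.\<close>
  define h where "h = (\<lambda>w. \<Sum>k\<in>UNIV. w ^ m k * (f i k w * g k j w))"
  have "h \<in> disk_algebra"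
    unfolding h_def by (intro disk_algebra_sum disk_algebra_power_mult disk_algebra_mult fg)
  moreover have "(F z ** G z) $ i $ j = z ^ cyc_len e i j * h (z ^ CARD('n))" for z
  proof -
    have "F z $ i $ k * G z $ k $ j =
        z ^ cyc_len e i j * ((z ^ CARD('n)) ^ m k * (f i k (z ^ CARD('n)) * g k j (z ^ CARD('n))))" for k
    proof -
      have "F z $ i $ k * G z $ k $ j =
          z ^ (cyc_len e i k + cyc_len e k j) * (f i k (z ^ CARD('n)) * g k j (z ^ CARD('n)))"
        by (simp add: fg power_add)
      also have "\<dots> = z ^ cyc_len e i j *
          ((z ^ CARD('n)) ^ m k * (f i k (z ^ CARD('n)) * g k j (z ^ CARD('n))))"
        unfolding m by (simp add: power_add power_mult)
      finally show ?thesis .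
    qed
    thus ?thesis by (simp add: matrix_matrix_mult_def h_def sum_distrib_left)
  qed
  ultimately show "\<exists>h\<in>disk_algebra. \<forall>z. (F z ** G z) $ i $ j = z ^ cyc_len e i j * h (z ^ CARD('n))"
    by blast
qed

section \<open>The operator norm\<close>

lemma op_norm_le_sum:
  fixes M :: "complex ^ 'n ^ 'n"
  shows "op_norm M \<le> (\<Sum>i\<in>UNIV. \<Sum>j\<in>UNIV. norm (M $ i $ j))"
  unfolding op_norm_def
proof (rule onorm_le)
  fix v :: "complex ^ 'n"
  \<comment> \<open>Bounding the Euclidean norm by the sum of the coordinate moduli loses a factor
    depending on the dimension, which is harmless because n is fixed.\<close>
  have "norm (M *v v) \<le> (\<Sum>i\<in>UNIV. norm ((M *v v) $ i))"
    by (simp add: norm_vec_def L2_set_le_sum)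
  also have "\<dots> \<le> (\<Sum>i\<in>UNIV. (\<Sum>j\<in>UNIV. norm (M $ i $ j)) * norm v)"
  proof (rule sum_mono)
    fix i
    have "norm ((M *v v) $ i) \<le> (\<Sum>j\<in>UNIV. norm (M $ i $ j * v $ j))"
      by (simp add: matrix_vector_mult_def norm_sum)
    also have "\<dots> \<le> (\<Sum>j\<in>UNIV. norm (M $ i $ j) * norm v)"
      by (intro sum_mono) (simp add: norm_mult mult_left_mono Finite_Cartesian_Product.norm_nth_le)
    finally show "norm ((M *v v) $ i) \<le> (\<Sum>j\<in>UNIV. norm (M $ i $ j)) * norm v"
      by (simp add: sum_distrib_right)
  qed
  finally show "norm (M *v v) \<le> (\<Sum>i\<in>UNIV. \<Sum>j\<in>UNIV. norm (M $ i $ j)) * norm v"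
    by (simp add: sum_distrib_right)
qed

lemma bounded_linear_matrix_vector_mult: "bounded_linear (\<lambda>v. (M :: complex ^ 'n ^ 'm) *v v)"
proof -
  have "linear (\<lambda>v. M *v v)"
    by (rule linearI)
       (simp_all add: vec_eq_iff matrix_vector_mult_def scaleR_sum_right distrib_left sum.distrib)
  thus ?thesis by (simp add: linear_conv_bounded_linear)
qed

lemma op_norm_eq_0: "op_norm M = 0 \<Longrightarrow> M = 0"
proof -
  assume "op_norm M = 0"
  hence "\<And>v. M *v v = 0"
    unfolding op_norm_def by (simp add: onorm_eq_0 bounded_linear_matrix_vector_mult)
  thus "M = 0" by (simp add: matrix_eq)
qed

lemma op_norm_nonneg: "0 \<le> op_norm M"
  unfolding op_norm_def by (rule onorm_pos_le) (rule bounded_linear_matrix_vector_mult)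

section \<open>An approximate unit vanishing at a boundary point\<close>

lemma approximate_unit_denominator:
  fixes \<mu> w :: complex
  assumes "norm \<mu> = 1" "norm w \<le> 1" "0 < t"
  shows "t \<le> norm ((1 + of_real t) * \<mu> - w)"
proof -
  \<comment> \<open>The pole \<open>(1 + t) * \<mu>\<close> has modulus \<open>1 + t\<close>, so it
    keeps distance at least \<open>t\<close> from the closed disk.\<close>
  have "norm ((1 + of_real t) * \<mu>) = 1 + t"
  proof -
    have "1 + of_real t = (of_real (1 + t) :: complex)" by simp
    thus ?thesis using assms by (simp only: norm_mult norm_of_real) simp
  qed
  thus ?thesis using norm_triangle_ineq2[of "(1 + of_real t) * \<mu>" w] assms by linarith
qed

text \<open>The fraction has modulus at most 1 on the closed disk and tends to 0 uniformly away from
  \<open>\<mu>\<close>, whereas \<open>f\<close> is small near \<open>\<mu>\<close>. Hence the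
  product is uniformly small.\<close>

lemma approximate_unit_uniform:
  fixes \<mu> :: complex
  assumes f: "f \<in> disk_algebra" "f \<mu> = 0" and \<mu>: "norm \<mu> = 1" and \<eta>: "0 < \<eta>"
  shows "\<forall>\<^sub>F t in at_right 0. \<forall>w\<in>cball 0 1.
    norm (of_real t * \<mu> / ((1 + of_real t) * \<mu> - w) * f w) \<le> \<eta>"
proof -
  have cont: "continuous_on (cball 0 1) f" using f by (simp add: disk_algebra_def)
  hence "bounded (f ` cball 0 1)"
    by (intro compact_imp_bounded compact_continuous_image) auto
  then obtain B where B: "B > 0" "\<And>w. w \<in> cball 0 1 \<Longrightarrow> norm (f w) \<le> B"
    by (metis bounded_pos imageI)
  obtain \<delta> where \<delta>: "\<delta> > 0" "\<And>w. w \<in> cball 0 1 \<Longrightarrow> dist w \<mu> < \<delta> \<Longrightarrow> norm (f w) < \<eta>"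
  proof -
    have "\<mu> \<in> cball 0 1" using \<mu> by simp
    then obtain \<delta> where "\<delta> > 0" "\<forall>w\<in>cball 0 1. dist w \<mu> < \<delta> \<longrightarrow> dist (f w) (f \<mu>) < \<eta>"
      using cont \<eta> unfolding continuous_on_iff by blast
    thus ?thesis using that f(2) by simp
  qed
  \<comment> \<open>The second bound amounts to \<open>t * B < \<eta> * (\<delta> - t)\<close>, the
    inequality required for points far from \<open>\<mu>\<close>.\<close>
  have "\<forall>\<^sub>F t in at_right 0. t < min \<delta> (\<eta> * \<delta> / (B + \<eta>))"
    using \<delta> B \<eta> by (intro order_tendstoD(2)[OF tendsto_ident_at]) auto
  moreover have "\<forall>\<^sub>F t::real in at_right 0. 0 < t"
    by (rule eventually_at_right_less)
  ultimately show ?thesis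
  proof eventually_elim
    case (elim t)
    show ?case
    proof
      fix w :: complex
      assume w: "w \<in> cball 0 1"
      define r where "r = norm ((1 + of_real t) * \<mu> - w)"
      have r: "t \<le> r"
        unfolding r_def using w \<mu> elim by (intro approximate_unit_denominator) auto
      have eq: "norm (of_real t * \<mu> / ((1 + of_real t) * \<mu> - w) * f w) = t * norm (f w) / r"
        using elim \<mu> by (simp add: norm_mult norm_divide r_def)
      \<comment> \<open>Near \<open>\<mu>\<close> one combines
        \<open>norm (f w) \<le> \<eta>\<close> with \<open>t \<le> r\<close>; elsewhere
        \<open>norm (f w) \<le> B\<close> with \<open>\<delta> - t \<le> r\<close>.\<close>
      have "t * norm (f w) \<le> \<eta> * r"
      proof (cases "dist w \<mu> < \<delta>")
        case True
        hence "norm (f w) \<le> \<eta>" using \<delta>(2)[OF w] by linarith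
        hence "norm (f w) * t \<le> \<eta> * r" using r elim \<eta> by (intro mult_mono) auto
        thus ?thesis by (simp add: mult.commute)
      next
        case False
        have "(1 + of_real t) * \<mu> - w = of_real t * \<mu> - (w - \<mu>)" by (simp add: algebra_simps)
        hence "norm (w - \<mu>) - norm (of_real t * \<mu>) \<le> r"
          unfolding r_def by (metis norm_minus_commute norm_triangle_ineq2)
        hence "\<delta> - t \<le> r" using False \<mu> elim by (simp add: dist_norm norm_mult)
        hence "\<eta> * (\<delta> - t) \<le> \<eta> * r" using \<eta> by simp
        moreover have "t * (B + \<eta>) \<le> \<eta> * \<delta>" using elim B \<eta> by (simp add: field_simps)
        moreover have "t * norm (f w) \<le> t * B" using B(2)[OF w] elim by simp
        ultimately show ?thesis by (simp add: algebra_simps)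
      qed
      thus "norm (of_real t * \<mu> / ((1 + of_real t) * \<mu> - w) * f w) \<le> \<eta>"
        unfolding eq using r elim by (simp add: field_simps)
    qed
  qed
qed

text \<open>A scalar function of z^n times the identity matrix lies in the algebra and multiplies
  all entries of \<open>F\<close> alike. The problem thus reduces to the finitely many scalar
  functions \<open>f i j\<close>, all vanishing at \<open>\<mu>\<close>.\<close>

lemma kernel_approximate_unit:
  fixes e :: "'n::finite \<Rightarrow> nat"
  assumes lam: "norm lam = 1" and F: "F \<in> cycle_algebra e" "F lam = 0" and \<delta>: "0 < \<delta>"
  shows "\<exists>G\<in>cycle_algebra e. G lam = 0 \<and> disk_norm (\<lambda>z. G z ** F z - F z) < \<delta>"
proof -
  let ?n = "CARD('n)"
  define \<mu> where "\<mu> = lam ^ ?n"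
  have \<mu>: "norm \<mu> = 1" by (simp add: \<mu>_def norm_power lam)
  obtain f where f: "\<And>i j. f i j \<in> disk_algebra"
    "\<And>i j z. F z $ i $ j = z ^ cyc_len e i j * f i j (z ^ ?n)"
    using F(1) unfolding cycle_algebra_iff by metis
  \<comment> \<open>As \<open>lam\<close> is nonzero, the factor \<open>lam ^ cyc_len e i j\<close>
    cancels.\<close>
  have f_\<mu>: "f i j \<mu> = 0" for i j
    using f(2)[of lam i j] F(2) lam by (auto simp: \<mu>_def)
  \<comment> \<open>Summing \<open>\<eta>\<close> over the n * n entries gives
    \<open>\<delta> / 2\<close>, which leaves room for the strict inequality.\<close>
  define \<eta> where "\<eta> = \<delta> / (2 * real ?n * real ?n)"
  have \<eta>: "\<eta> > 0" using \<delta> by (simp add: \<eta>_def)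
  define u where "u = (\<lambda>t w. of_real t * \<mu> / ((1 + of_real t) * \<mu> - w))"
  \<comment> \<open>Finiteness of the index type allows one \<open>t\<close> to serve all entries at
    once.\<close>
  have "\<forall>\<^sub>F t in at_right 0. \<forall>i j. \<forall>w\<in>cball 0 1. norm (u t w * f i j w) \<le> \<eta>"
    unfolding u_def by (intro eventually_all_finite approximate_unit_uniform f f_\<mu> \<mu> \<eta>)
  moreover have "\<forall>\<^sub>F t::real in at_right 0. 0 < t"
    by (rule eventually_at_right_less)
  ultimately have "\<forall>\<^sub>F t in at_right 0. 0 < t \<and>
      (\<forall>i j. \<forall>w\<in>cball 0 1. norm (u t w * f i j w) \<le> \<eta>)"
    by eventually_elim auto
  then obtain t :: real where t: "t > 0"
    and small: "\<And>i j w. w \<in> cball 0 1 \<Longrightarrow> norm (u t w * f i j w) \<le> \<eta>"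
    using eventually_happens'[OF trivial_limit_at_right_real] by blast
  have nz: "(1 + of_real t) * \<mu> - w \<noteq> 0" if "norm w \<le> 1" for w
    using approximate_unit_denominator[OF \<mu> that t] t by auto
  \<comment> \<open>By \<open>nz\<close> the pole of \<open>u t\<close> lies outside the closed
    disk, so the truncated \<open>1 - u t\<close> is in the disk algebra; it vanishes at
    \<open>\<mu>\<close> because \<open>u t \<mu> = 1\<close>.\<close>
  define g where "g = (\<lambda>w. if w \<in> cball 0 1 then 1 - u t w else 0)"
  define G :: "complex \<Rightarrow> complex ^ 'n ^ 'n" where "G = (\<lambda>z. mat (g (z ^ ?n)))"
  have g: "g \<in> disk_algebra"
    unfolding g_def u_def using nz
    by (intro disk_algebra_restrict continuous_intros holomorphic_intros) auto
  have "G \<in> cycle_algebra e"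
    unfolding cycle_algebra_iff
  proof (intro allI)
    fix i j
    show "\<exists>h\<in>disk_algebra. \<forall>z. G z $ i $ j = z ^ cyc_len e i j * h (z ^ ?n)"
      by (rule bexI[of _ "if i = j then g else (\<lambda>w. 0)"])
         (auto simp: G_def mat_def cyc_len_self g disk_algebra_zero)
  qed
  moreover have "G lam = 0"
  proof -
    have "(1 + of_real t) * \<mu> - \<mu> = of_real t * \<mu>" by (simp add: ring_distribs)
    moreover have "of_real t * \<mu> \<noteq> 0" using t \<mu> by auto
    ultimately have "u t \<mu> = 1" by (simp add: u_def)
    thus ?thesis using \<mu> by (simp add: G_def g_def vec_eq_iff mat_def flip: \<mu>_def)
  qed
  moreover have "disk_norm (\<lambda>z. G z ** F z - F z) \<le> \<delta> / 2"
    unfolding disk_norm_def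
  proof (rule cSUP_least)
    fix z :: complex assume z: "z \<in> cball 0 1"
    hence zn: "z ^ ?n \<in> cball 0 1" by (simp add: norm_power power_le_one)
    have GF: "(G z ** F z) $ i $ j = g (z ^ ?n) * F z $ i $ j" for i j
      by (simp add: G_def mat_def matrix_matrix_mult_def if_distrib if_distribR cong: if_cong)
    have "norm ((G z ** F z - F z) $ i $ j) \<le> \<eta>" for i j
    proof -
      have "(G z ** F z - F z) $ i $ j = - (z ^ cyc_len e i j * (u t (z ^ ?n) * f i j (z ^ ?n)))"
        using zn by (simp add: GF f(2) g_def algebra_simps)
      hence "norm ((G z ** F z - F z) $ i $ j) =
          norm z ^ cyc_len e i j * norm (u t (z ^ ?n) * f i j (z ^ ?n))"
        by (simp add: norm_mult norm_power)
      also have "\<dots> \<le> 1 * \<eta>"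
        using z small[OF zn] by (intro mult_mono power_le_one) auto
      finally show ?thesis by simp
    qed
    hence "(\<Sum>i\<in>UNIV. \<Sum>j\<in>UNIV. norm ((G z ** F z - F z) $ i $ j)) \<le>
        (\<Sum>i\<in>(UNIV :: 'n set). \<Sum>j\<in>(UNIV :: 'n set). \<eta>)"
      by (intro sum_mono)
    also have "\<dots> = \<delta> / 2" by (simp add: \<eta>_def field_simps)
    finally show "op_norm (G z ** F z - F z) \<le> \<delta> / 2"
      using op_norm_le_sum order_trans by blast
  qed auto
  ultimately show ?thesis using \<delta> by (intro bexI[of _ G]) auto
qed

section \<open>From vanishing on the kernel to inner derivations\<close>

lemma point_derivation_kernel:
  fixes e :: "'n::finite \<Rightarrow> nat"
  assumes D: "point_derivation (cycle_algebra e) (phi lam) D" and lam: "norm lam = 1"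
    and F: "F \<in> cycle_algebra e" "F lam = 0"
  shows "D F = 0"
proof (rule ccontr)
  assume "D F \<noteq> 0"
  hence "op_norm (D F) > 0" using op_norm_eq_0 op_norm_nonneg by (metis order_le_less)
  moreover have "\<forall>\<epsilon>>0. \<exists>\<delta>>0. \<forall>G\<in>cycle_algebra e.
      disk_norm (\<lambda>z. G z - F z) < \<delta> \<longrightarrow> op_norm (D G - D F) < \<epsilon>"
    using D F(1) by (simp add: point_derivation_def continuous_on_algebra_def)
  \<comment> \<open>Continuity at \<open>F\<close> is applied with \<epsilon> equal to
    \<open>op_norm (D F)\<close>. An element that \<open>D\<close> kills can then not come within
    \<open>\<delta>\<close> of \<open>F\<close>.\<close>
  ultimately have "\<exists>\<delta>>0. \<forall>G\<in>cycle_algebra e.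
      disk_norm (\<lambda>z. G z - F z) < \<delta> \<longrightarrow> op_norm (D G - D F) < op_norm (D F)"
    by (simp only: simp_thms)
  then obtain \<delta> where \<delta>: "\<delta> > 0" "\<And>G. G \<in> cycle_algebra e \<Longrightarrow>
      disk_norm (\<lambda>z. G z - F z) < \<delta> \<Longrightarrow> op_norm (D G - D F) < op_norm (D F)"
    by auto
  obtain G where G: "G \<in> cycle_algebra e" "G lam = 0" "disk_norm (\<lambda>z. G z ** F z - F z) < \<delta>"
    using kernel_approximate_unit[OF lam F \<delta>(1)] by blast
  \<comment> \<open>Each Leibniz term contains the value of \<open>F\<close> or of \<open>G\<close>
    at \<open>lam\<close>, and both values are zero.\<close>
  have "D (\<lambda>z. G z ** F z) = 0"
    using D G F by (simp add: point_derivation_def phi_def)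
  hence "op_norm (- D F) < op_norm (D F)"
    using \<delta>(2)[OF cycle_algebra_mult[OF G(1) F(1)] G(3)] by simp
  moreover have "op_norm (- D F) = op_norm (D F)"
  proof -
    have "(- D F) *v v = - (D F *v v)" for v
      by (simp add: vec_eq_iff matrix_vector_mult_def sum_negf)
    thus ?thesis by (simp add: op_norm_def onorm_neg)
  qed
  ultimately show False by simp
qed

text \<open>The difference of \<open>F\<close> and \<open>G\<close> lies in the kernel, where
  \<open>D\<close> vanishes. Thus \<open>D\<close> depends only on the value at \<open>lam\<close>
  and may be computed on any lift of a matrix.\<close>

lemma point_derivation_cong:
  fixes e :: "'n::finite \<Rightarrow> nat"
  assumes D: "point_derivation (cycle_algebra e) (phi lam) D" and lam: "norm lam = 1"
    and FG: "F \<in> cycle_algebra e" "G \<in> cycle_algebra e" "F lam = G lam"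
  shows "D F = D G"
proof -
  define H where "H = (\<lambda>z. F z + scale_mat (-1) (G z))"
  have H: "H \<in> cycle_algebra e"
    unfolding H_def by (intro cycle_algebra_add cycle_algebra_scale FG)
  have "H lam = 0" by (simp add: H_def FG scale_mat_def vec_eq_iff)
  hence "D H = 0" using point_derivation_kernel[OF D lam H] by blast
  moreover have "D (\<lambda>z. G z + H z) = D G + D H"
    using D H FG by (simp add: point_derivation_def linear_on_algebra_def)
  moreover have "(\<lambda>z. G z + H z) = F"
    by (simp add: H_def scale_mat_def vec_eq_iff fun_eq_iff)
  ultimately show ?thesis by simp
qed

lemma point_derivation_inner:
  fixes e :: "'n::finite \<Rightarrow> nat"
  assumes D: "point_derivation (cycle_algebra e) (phi lam) D" and lam: "norm lam = 1"
  shows "inner_at (cycle_algebra e) (phi lam) D"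
proof -
  define one :: "complex \<Rightarrow> complex" where "one = (\<lambda>z. if z \<in> cball 0 1 then 1 else 0)"
  have one: "one \<in> disk_algebra"
    unfolding one_def by (intro disk_algebra_restrict) auto
  \<comment> \<open>A section of evaluation at \<open>lam\<close>: dividing by
    \<open>lam ^ cyc_len e i j\<close> is legitimate since \<open>lam\<close> is nonzero, and
    \<open>one\<close> takes the value 1 at lam^n because that point lies on the unit
    circle.\<close>
  define L :: "complex ^ 'n ^ 'n \<Rightarrow> complex \<Rightarrow> complex ^ 'n ^ 'n" where
    "L = (\<lambda>M z. \<chi> i j. z ^ cyc_len e i j * (M $ i $ j / lam ^ cyc_len e i j * one (z ^ CARD('n))))"
  have L: "L M \<in> cycle_algebra e" for M
    unfolding cycle_algebra_iff
  proof (intro allI)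
    fix i j
    show "\<exists>f\<in>disk_algebra. \<forall>z. L M z $ i $ j = z ^ cyc_len e i j * f (z ^ CARD('n))"
      by (rule bexI[of _ "\<lambda>w. M $ i $ j / lam ^ cyc_len e i j * one w"])
         (simp_all only: L_def vec_lambda_beta disk_algebra_cmult one simp_thms)
  qed
  have L_lam: "L M lam = M" for M
    using lam by (auto simp: L_def one_def vec_eq_iff norm_power)
  have lin: "D (\<lambda>z. F z + G z) = D F + D G" "D (\<lambda>z. scale_mat c (F z)) = scale_mat c (D F)"
    and mult: "D (\<lambda>z. F z ** G z) = D F ** G lam + F lam ** D G"
    if "F \<in> cycle_algebra e" "G \<in> cycle_algebra e" for F G c
    using D that by (auto simp: point_derivation_def linear_on_algebra_def phi_def)
  note cong = point_derivation_cong[OF D lam]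
  have "\<exists>X. \<forall>M. D (L M) = M ** X - X ** M"
  proof (rule matrix_derivation_inner)
    fix M N c
    have "D (L (M + N)) = D (\<lambda>z. L M z + L N z)"
      by (intro cong cycle_algebra_add L) (simp add: L_lam)
    thus "D (L (M + N)) = D (L M) + D (L N)" by (simp add: lin L)
    have "D (L (scale_mat c M)) = D (\<lambda>z. scale_mat c (L M z))"
      by (intro cong cycle_algebra_scale L) (simp add: L_lam)
    thus "D (L (scale_mat c M)) = scale_mat c (D (L M))" by (simp add: lin[OF L L])
    \<comment> \<open>The lift \<open>L\<close> need not be multiplicative, but both arguments of
      \<open>D\<close> have the value \<open>M ** N\<close> at \<open>lam\<close>, which is all that
      \<open>cong\<close> asks for.\<close>
    have "D (L (M ** N)) = D (\<lambda>z. L M z ** L N z)"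
      by (intro cong cycle_algebra_mult L) (simp add: L_lam)
    thus "D (L (M ** N)) = D (L M) ** N + M ** D (L N)" by (simp add: mult L L_lam)
  qed
  then obtain X where X: "\<And>M. D (L M) = M ** X - X ** M" by blast
  \<comment> \<open>\<open>F\<close> and the lift of its own value at \<open>lam\<close> agree at
    \<open>lam\<close>.\<close>
  have "D F = F lam ** X - X ** F lam" if "F \<in> cycle_algebra e" for F
    using cong[OF that L[of "F lam"]] X L_lam by simp
  thus ?thesis by (auto simp: inner_at_def phi_def)
qed

theorem theorem3:
  fixes e :: "'n::finite \<Rightarrow> nat" and lam :: complex
    and D :: "(complex \<Rightarrow> complex ^ 'n ^ 'n) \<Rightarrow> complex ^ 'n ^ 'n"
  assumes "bij_betw e UNIV {1..CARD('n)}"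
    and "lam \<in> sphere 0 1"
    and "point_derivation (cycle_algebra e) (phi lam) D"
  shows "inner_at (cycle_algebra e) (phi lam) D"
  using point_derivation_inner[OF assms(3)] assms(2) by simp

end
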